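(* Let $b\geq 2$ be an integer. If there exists a $v$-palindrome in base $b$, then there exist infinitely many $v$-palindromes in base $b$.
   Context: Natural numbers are positive integers. Every natural number $n$ has a unique base $b$ representation ($b\ge 2$) $n=a_0+a_1b+\cdots+a_{L-1}b^{L-1}$ with $L\ge 1$, integers $0\le a_i<b$ and $a_{L-1}\ne 0$. The digit reversal of $n$ in base $b$ is $r_b(n)=a_{L-1}+a_{L-2}b+\cdots+a_0b^{L-1}$. The function $v$ on natural numbers: if $n=p_1^{\varepsilon_1}\cdots p_s^{\varepsilon_s}q_1\cdots q_t$ with $s,t\ge 0$, integers $\varepsilon_i\ge 2$ and distinct primes $p_1,\dots,p_s,q_1,\dots,q_t$, then $v(n)=\sum_{i=1}^s(p_i+\varepsilon_i)+\sum_{j=1}^t q_j$ (so $v(1)=0$). A natural number $n$ is a $v$-palindrome in base $b$ if (i) $b\nmid n$, (ii) $n\ne r_b(n)$, and (iii) $v(n)=v(r_b(n))$. *)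

theory Defs
  imports "HOL-Computational_Algebra.Computational_Algebra"
begin

text \<open>Base \<open>b\<close> digits, least significant first; meaningful for \<open>b \<ge> 2\<close>
  (the guard \<open>b < 2\<close> only ensures termination). The facts \<open>base_digits_ne_Nil\<close> to
  \<open>base_digits_unique\<close> say that, for \<open>n > 0\<close>, this is the unique base \<open>b\<close> representation of \<open>n\<close>.\<close>

fun base_digits :: "nat \<Rightarrow> nat \<Rightarrow> nat list" where
  "base_digits b n = (if b < 2 \<or> n = 0 then [] else n mod b # base_digits b (n div b))"

declare base_digits.simps [simp del]

lemma base_digits_0 [simp]: "base_digits b 0 = []"
  by (simp add: base_digits.simps)

lemma base_digits_ne_Nil: "2 \<le> b \<Longrightarrow> 0 < n \<Longrightarrow> base_digits b n \<noteq> []"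
  by (subst base_digits.simps) simp

lemma horner_sum_base_digits: "2 \<le> b \<Longrightarrow> horner_sum id b (base_digits b n) = n"
proof (induction b n rule: base_digits.induct)
  case (1 b n)
  then show ?case
    by (subst base_digits.simps) (auto simp: id_def)
qed

lemma base_digits_less: "2 \<le> b \<Longrightarrow> d \<in> set (base_digits b n) \<Longrightarrow> d < b"
proof (induction b n rule: base_digits.induct)
  case (1 b n)
  from "1.prems"(2) show ?case
    by (subst (asm) base_digits.simps) (use 1 in \<open>auto split: if_splits\<close>)
qed

lemma last_base_digits: "2 \<le> b \<Longrightarrow> 0 < n \<Longrightarrow> last (base_digits b n) \<noteq> 0"
proof (induction b n rule: base_digits.induct)
  case (1 b n)
  show ?case
  proof (cases "n < b")
    case True
    then show ?thesis
      using "1.prems" by (subst base_digits.simps) simp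
  next
    case False
    then have "0 < n div b"
      using "1.prems" by (simp add: div_greater_zero_iff)
    then show ?thesis
      using 1 base_digits_ne_Nil[of b "n div b"] by (subst base_digits.simps) simp
  qed
qed

lemma base_digits_unique:
  assumes "2 \<le> b" "ds \<noteq> []" "\<forall>d\<in>set ds. d < b" "last ds \<noteq> 0" "horner_sum id b ds = n"
  shows "ds = base_digits b n"
  using assms(2-)
proof (induction ds arbitrary: n)
  case Nil
  then show ?case by simp
next
  case (Cons d ds)
  let ?m = "horner_sum id b ds"
  have n: "n = d + b * ?m" and d: "d < b"
    using Cons.prems by (auto simp: id_def)
  then have md: "n mod b = d" "n div b = ?m"
    using assms(1) by auto
  have ds: "ds = base_digits b ?m"
    using Cons by (cases "ds = []") (auto simp: id_def)
  have "n \<noteq> 0"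
  proof
    assume "n = 0"
    then have "d = 0" "?m = 0" using n assms(1) by auto
    then have "ds = []" using ds by simp
    then show False using \<open>d = 0\<close> Cons.prems by simp
  qed
  then show ?case
    using md ds assms(1) by (subst base_digits.simps) simp
qed

definition digit_reversal :: "nat \<Rightarrow> nat \<Rightarrow> nat" where
  "digit_reversal b n = horner_sum id b (rev (base_digits b n))"

text \<open>A prime factor of multiplicity \<open>1\<close> contributes only \<open>p\<close>, not \<open>p + 1\<close>.\<close>

definition v_fun :: "nat \<Rightarrow> nat" where
  "v_fun n = (\<Sum>p\<in>prime_factors n. if multiplicity p n \<ge> 2 then p + multiplicity p n else p)"

definition v_palindrome :: "nat \<Rightarrow> nat \<Rightarrow> bool" where
  "v_palindrome b n \<longleftrightarrow>
     0 < n \<and> \<not> b dvd n \<and> n \<noteq> digit_reversal b n \<and> v_fun n = v_fun (digit_reversal b n)"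

end

theory Submission
  imports Defs "HOL-Number_Theory.Residues"
begin

text \<open>Write a \<open>v\<close>-palindrome \<open>n\<close> of \<open>L\<close> digits \<open>k\<close> times in a row. The result is \<open>n * R\<close> with
  \<open>R = 1 + x + \<dots> + x ^ (k - 1)\<close> and \<open>x = b ^ L\<close>, and reversing its digits yields \<open>k\<close> copies of the
  reversal \<open>r\<close> of \<open>n\<close>, that is \<open>r * R\<close>, with the same factor \<open>R\<close>
  (\<open>digit_reversal_repeated\<close>). Since \<open>v\<close> turns coprime products into sums
  (\<open>v_fun_mult_coprime\<close>), \<open>v n = v r\<close> implies \<open>v (n * R) = v (r * R)\<close> as soon as \<open>R\<close> is coprime to
  both \<open>n\<close> and \<open>r\<close>.

  Infinitely many \<open>k\<close> achieve this, because the sequence \<open>R\<close> is periodic in \<open>k\<close> modulo each prime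
  \<open>p\<close> once \<open>k \<ge> 1\<close>, with \<open>p * (p - 1)\<close> as a period, and \<open>R = 1\<close> for \<open>k = 1\<close>
  (\<open>prime_not_dvd_geometric_sum\<close>). Any \<open>k\<close> that is \<open>1\<close> modulo \<open>(n * r)!\<close> therefore works for all
  prime divisors of \<open>n * r\<close> at once.\<close>

lemma v_fun_mult_coprime:
  assumes "coprime m n" "0 < m" "0 < n"
  shows "v_fun (m * n) = v_fun m + v_fun n"
proof -
  have disj: "prime_factors m \<inter> prime_factors n = {}"
    using assms(1) by (auto simp: in_prime_factors_iff dest: coprime_common_divisor)
  have mult: "multiplicity p (m * n) = multiplicity p m + multiplicity p n" if "prime p" for p
    using that assms by (intro prime_elem_multiplicity_mult_distrib) auto
  have left: "multiplicity p (m * n) = multiplicity p m" if "p \<in> prime_factors m" for p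
  proof -
    have "\<not> p dvd n"
      using that disj assms(3) by (auto simp: in_prime_factors_iff)
    then show ?thesis
      using that mult[of p] by (simp add: in_prime_factors_iff not_dvd_imp_multiplicity_0)
  qed
  have right: "multiplicity p (m * n) = multiplicity p n" if "p \<in> prime_factors n" for p
  proof -
    have "\<not> p dvd m"
      using that disj assms(2) by (auto simp: in_prime_factors_iff)
    then show ?thesis
      using that mult[of p] by (simp add: in_prime_factors_iff not_dvd_imp_multiplicity_0)
  qed
  have "prime_factors (m * n) = prime_factors m \<union> prime_factors n"
    using assms by (intro prime_factors_product) auto
  then show ?thesis
    using disj left right
    by (simp add: v_fun_def sum.union_disjoint cong: sum.cong if_cong)
qed

lemma horner_sum_concat_replicate:
  fixes b :: nat
  shows "horner_sum id b (concat (replicate k ds)) =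
    horner_sum id b ds * (\<Sum>i<k. (b ^ length ds) ^ i)"
proof (induction k)
  case 0
  show ?case by simp
next
  case (Suc k)
  then show ?case
    by (simp add: horner_sum_append sum.lessThan_Suc_shift sum_distrib_left algebra_simps
        del: sum.lessThan_Suc)
qed

lemma digit_reversal_pos:
  assumes "2 \<le> b" "0 < n"
  shows "0 < digit_reversal b n"
proof -
  have "rev (base_digits b n) = last (base_digits b n) # rev (butlast (base_digits b n))"
    using base_digits_ne_Nil[OF assms] by (metis append_butlast_last_id rev_eq_Cons_iff rev_rev_ident)
  then have "digit_reversal b n
      = last (base_digits b n) + b * horner_sum id b (rev (butlast (base_digits b n)))"
    by (simp only: digit_reversal_def horner_sum_simps id_apply)
  then show ?thesis
    using last_base_digits[OF assms] by simp
qed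

text \<open>The repeated block is again a digit expansion with nonzero leading digit, so uniqueness of
  digits applies to it; reversing it reverses each block, and all blocks are equal.\<close>

lemma digit_reversal_repeated:
  fixes b n :: nat
  defines "x \<equiv> b ^ length (base_digits b n)"
  assumes "2 \<le> b" "0 < n" "0 < k"
  shows "digit_reversal b (n * (\<Sum>i<k. x ^ i)) = digit_reversal b n * (\<Sum>i<k. x ^ i)"
proof -
  define ds where "ds = base_digits b n"
  define es where "es = concat (replicate k ds)"
  have ds: "ds \<noteq> []" "last ds \<noteq> 0" "\<forall>d\<in>set ds. d < b" "horner_sum id b ds = n"
    using assms base_digits_ne_Nil last_base_digits base_digits_less horner_sum_base_digits
    by (auto simp: ds_def)
  obtain j where k: "k = Suc j"
    using \<open>0 < k\<close> gr0_conv_Suc by blast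
  then have es_snoc: "es = concat (replicate j ds) @ ds"
    unfolding es_def by (simp only: replicate_append_same[symmetric] replicate_Suc concat_append) simp
  have "es = base_digits b (n * (\<Sum>i<k. x ^ i))"
  proof (rule base_digits_unique)
    show "horner_sum id b es = n * (\<Sum>i<k. x ^ i)"
      unfolding es_def horner_sum_concat_replicate ds(4) by (simp add: x_def ds_def)
    show "\<forall>d\<in>set es. d < b"
      using ds(3) by (auto simp: es_def)
  qed (use ds es_snoc assms in auto)
  moreover have "rev es = concat (replicate k (rev ds))"
    by (simp add: es_def rev_concat)
  ultimately show ?thesis
    by (metis digit_reversal_def ds_def horner_sum_concat_replicate length_rev x_def)
qed

text \<open>The factor \<open>p - 1\<close> of \<open>N\<close> makes \<open>x ^ N - 1\<close> vanish modulo \<open>p\<close>, which settles the case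
  where \<open>x - 1\<close> is invertible modulo \<open>p\<close>; if \<open>x\<close> is \<open>1\<close> modulo \<open>p\<close>, the sum is \<open>N\<close> modulo \<open>p\<close>, and the
  factor \<open>p\<close> is what counts.\<close>

lemma prime_dvd_geometric_sum:
  fixes x p N :: nat
  assumes "prime p" "\<not> p dvd x" "p * (p - 1) dvd N"
  shows "p dvd (\<Sum>i<N. x ^ i)"
proof (cases "[x = 1] (mod p)")
  case True
  have "[(\<Sum>i<N. x ^ i) = (\<Sum>i<N. 1 ^ i)] (mod p)"
    by (intro cong_sum cong_pow True)
  moreover have "p dvd N"
    using assms(3) by (rule dvd_mult_left)
  ultimately show ?thesis
    by (simp add: cong_dvd_iff)
next
  case False
  from assms(3) obtain t where N: "N = (p - 1) * t"
    by (metis dvdE dvd_mult_right)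
  have "[x ^ N = 1] (mod p)"
    using cong_pow[OF fermat_theorem[OF assms(1,2)], of t] by (simp add: N power_mult)
  then have "int p dvd int x ^ N - 1"
    using cong_int_iff[of "x ^ N" 1 p] by (simp add: cong_iff_dvd_diff)
  also have "int x ^ N - 1 = (int x - 1) * int (\<Sum>i<N. x ^ i)"
    by (simp add: power_diff_1_eq)
  finally have "int p dvd int x - 1 \<or> int p dvd int (\<Sum>i<N. x ^ i)"
    using assms(1) by (intro prime_dvd_multD) simp_all
  moreover have "\<not> int p dvd int x - 1"
    using False cong_int_iff[of x 1 p] by (simp add: cong_iff_dvd_diff)
  ultimately show ?thesis
    by (simp only: int_dvd_int_iff simp_thms)
qed

text \<open>Splitting off the first term leaves \<open>x\<close> times a sum of \<open>N\<close> terms, which also vanishes modulo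
  the divisors of \<open>x\<close>; so the whole sum is \<open>1\<close> modulo \<open>p\<close>.\<close>

lemma prime_not_dvd_geometric_sum:
  fixes x p N :: nat
  assumes "prime p" "p * (p - 1) dvd N"
  shows "\<not> p dvd (\<Sum>i<Suc N. x ^ i)"
proof -
  have "p dvd x * (\<Sum>i<N. x ^ i)"
    using prime_dvd_geometric_sum[OF assms(1) _ assms(2), of x] by (cases "p dvd x") auto
  moreover have "(\<Sum>i<Suc N. x ^ i) = 1 + x * (\<Sum>i<N. x ^ i)"
    by (simp add: sum.lessThan_Suc_shift sum_distrib_left del: sum.lessThan_Suc)
  ultimately show ?thesis
    using assms(1) by (metis dvd_add_left_iff not_prime_unit)
qed

text \<open>The factorial serves as a common multiple of the periods \<open>p * (p - 1)\<close> of all prime divisors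
  \<open>p \<le> m\<close> of \<open>m\<close>.\<close>

lemma coprime_geometric_sum:
  fixes x m N :: nat
  assumes "0 < m" "fact m dvd N"
  shows "coprime m (\<Sum>i<Suc N. x ^ i)"
proof (rule ccontr)
  assume "\<not> coprime m (\<Sum>i<Suc N. x ^ i)"
  then obtain p where p: "prime p" "p dvd m" "p dvd (\<Sum>i<Suc N. x ^ i)"
    by (metis coprime_iff_gcd_eq_1 gcd_nat.boundedE prime_factor_nat)
  have "p * (p - 1) dvd fact p"
    using prime_gt_0_nat[OF p(1)] dvd_fact[of "p - 1" "p - 1"] prime_gt_1_nat[OF p(1)]
    by (auto simp: fact_reduce intro!: mult_dvd_mono)
  also have "fact p dvd (fact m :: nat)"
    using p assms(1) by (intro fact_dvd dvd_imp_le) auto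
  also note assms(2)
  finally show False
    using prime_not_dvd_geometric_sum[OF p(1)] p(3) by blast
qed

theorem theorem5:
  fixes b :: nat
  assumes "b \<ge> 2"
    and "\<exists>n. v_palindrome b n"
  shows "infinite {n. v_palindrome b n}"
proof -
  obtain n where "v_palindrome b n"
    using assms(2) ..
  define r where "r = digit_reversal b n"
  have n: "0 < n" "\<not> b dvd n" "n \<noteq> r" "v_fun n = v_fun r"
    using \<open>v_palindrome b n\<close> by (auto simp: v_palindrome_def r_def)
  have "0 < r"
    unfolding r_def using assms(1) n(1) by (rule digit_reversal_pos)
  define x where "x = b ^ length (base_digits b n)"
  have "b dvd x"
    using base_digits_ne_Nil[OF assms(1) n(1)] by (simp add: x_def)
  then have "0 < x"
    using assms(1) by (simp add: x_def)
  have "\<exists>m\<ge>t. v_palindrome b m" for t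
  proof -
    define N where "N = t * fact (n * r)"
    define R where "R = (\<Sum>i<Suc N. x ^ i)"
    have "coprime (n * r) R"
      unfolding R_def N_def using n(1) \<open>0 < r\<close> by (intro coprime_geometric_sum) auto
    then have cop: "coprime n R" "coprime r R"
      by auto
    have "Suc N \<le> R"
      using sum_mono[of "{..<Suc N}" "\<lambda>_. 1" "\<lambda>i. x ^ i"] \<open>0 < x\<close> by (simp add: R_def Suc_le_eq)
    then have "0 < R"
      by simp
    have "t \<le> N"
      by (simp add: N_def)
    then have "t \<le> R"
      using \<open>Suc N \<le> R\<close> by linarith
    have rev: "digit_reversal b (n * R) = r * R"
      using digit_reversal_repeated[OF assms(1) n(1), of "Suc N"] by (simp only: r_def R_def x_def)
    have "R = 1 + x * (\<Sum>i<N. x ^ i)"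
      by (simp add: R_def sum.lessThan_Suc_shift sum_distrib_left del: sum.lessThan_Suc)
    then have "coprime x R"
      using gcd_add_mult[of x "\<Sum>i<N. x ^ i" 1] by (simp add: coprime_iff_gcd_eq_1 ac_simps)
    then have "coprime b R"
      using \<open>b dvd x\<close> by (rule coprime_divisors[OF _ dvd_refl, rotated])
    then have "\<not> b dvd n * R"
      using n(2) by (simp add: coprime_dvd_mult_left_iff)
    moreover have "v_fun (n * R) = v_fun (r * R)"
      using cop n(1,4) \<open>0 < r\<close> \<open>0 < R\<close> by (simp add: v_fun_mult_coprime)
    ultimately have "v_palindrome b (n * R)"
      using n(1,3) \<open>0 < R\<close> by (simp add: v_palindrome_def rev)
    moreover have "t \<le> n * R"
      using \<open>t \<le> R\<close> n(1) by (metis One_nat_def Suc_leI le_trans mult_1 mult_le_mono1)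
    ultimately show ?thesis
      by blast
  qed
  then show ?thesis
    by (simp add: infinite_nat_iff_unbounded_le)
qed

end
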